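(* Let $\mathscr{GP}=\mathscr{GP}(\Gamma,\mathcal{M})$ be a graph product of monoids. Every element of $\mathscr{GP}$ may be represented by a left Foata normal form; that is, every element of $\mathscr{GP}$ equals $[w]$ for some left Foata normal form $w\in X^*$.
   Context: Graph products: $\Gamma=\Gamma(V,E)$ is a simple undirected graph without loops, with vertex set $V$ (possibly infinite), $|V|\ge 2$, and edge set $E$ a set of $2$-element subsets of $V$; write $(\alpha,\beta)\in E$ for $\{\alpha,\beta\}\in E$ (so $(\alpha,\alpha)\notin E$). $\mathcal{M}=\{M_\alpha:\alpha\in V\}$ is a set of mutually disjoint monoids, $1_\alpha$ is the identity of $M_\alpha$, $I=\{1_\alpha:\alpha\in V\}$, $X=\bigcup_{\alpha\in V}M_\alpha$. $X^*$ is the free monoid on $X$, with juxtaposition $\circ$ and empty word $\epsilon$. $\mathscr{GP}=X^*/R^\sharp$, where $R^\sharp$ is the congruence generated by: $1_\alpha=\epsilon$ ($\alpha\in V$); $x\circ y=xy$ ($x,y\in M_\alpha$, $\alpha\in V$); $x\circ y=y\circ x$ ($x\in M_\alpha$, $y\in M_\beta$, $(\alpha,\beta)\in E$). $[w]$ denotes the class of $w\in X^*$ in $\mathscr{GP}$. Support: for $a\in M_\alpha$, $s(a)=\alpha$; for a word $x=x_1\circ\cdots\circ x_n$ with $x_i\in X$, $s(x)=\{s(x_i):1\le i\le n\}$, and $s(\epsilon)=\emptyset$. Reduced words: $x_1\circ\cdots\circ x_n\in X^*$ ($x_i\in X$) is reduced if no $x_i$ lies in $I$ and whenever $i<j$ and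 $s(x_i)=s(x_j)$, there is $k$ with $i<k<j$ and $(s(x_i),s(x_k))\notin E$. Left Foata normal form: a word $w\in X^*$ is a left Foata normal form with block length $k$ and (non-empty) blocks $w_1,\dots,w_k\in X^*$ if (i) $w=w_1\circ\cdots\circ w_k$ is reduced; (ii) $s(w_i)$ is a complete subgraph of $\Gamma$ (any two distinct vertices are adjacent) for all $i$; (iii) for any $1\le i<k$ and $\alpha\in s(w_{i+1})$ there is $\beta\in s(w_i)$ with $(\alpha,\beta)\notin E$. The empty word is a left Foata normal form with block length $0$. *)

theory Defs
  imports "HOL-Algebra.Group" "HOL-Library.Disjoint_Sets"
begin

definition simple_graph :: "'v set \<Rightarrow> 'v set set \<Rightarrow> bool" where
  "simple_graph V E \<longleftrightarrow> (\<forall>e\<in>E. e \<subseteq> V \<and> card e = 2)"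

definition complete_on :: "'v set set \<Rightarrow> 'v set \<Rightarrow> bool" where
  "complete_on E S \<longleftrightarrow> (\<forall>\<alpha>\<in>S. \<forall>\<beta>\<in>S. \<alpha> \<noteq> \<beta> \<longrightarrow> {\<alpha>, \<beta>} \<in> E)"

definition letters :: "'v set \<Rightarrow> ('v \<Rightarrow> ('a, 'b) monoid_scheme) \<Rightarrow> 'a set" where
  "letters V M = (\<Union>\<alpha>\<in>V. carrier (M \<alpha>))"

definition identities :: "'v set \<Rightarrow> ('v \<Rightarrow> ('a, 'b) monoid_scheme) \<Rightarrow> 'a set" where
  "identities V M = (\<lambda>\<alpha>. \<one>\<^bsub>M \<alpha>\<^esub>) ` V"

text \<open>The free monoid on \<open>X\<close> is \<open>lists X\<close>, with concatenation as product and \<open>[]\<close> as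
  empty word.\<close>

definition is_word_congruence :: "'a set \<Rightarrow> ('a list \<times> 'a list) set \<Rightarrow> bool" where
  "is_word_congruence X r \<longleftrightarrow> equiv (lists X) r \<and>
     (\<forall>u v u' v'. (u, v) \<in> r \<longrightarrow> (u', v') \<in> r \<longrightarrow> (u @ u', v @ v') \<in> r)"

definition generated_congruence ::
  "'a set \<Rightarrow> ('a list \<times> 'a list) set \<Rightarrow> ('a list \<times> 'a list) set" where
  "generated_congruence X R = \<Inter>{r. is_word_congruence X r \<and> R \<subseteq> r}"

definition gp_relators ::
  "'v set \<Rightarrow> 'v set set \<Rightarrow> ('v \<Rightarrow> ('a, 'b) monoid_scheme) \<Rightarrow> ('a list \<times> 'a list) set" where
  "gp_relators V E M =
     {([\<one>\<^bsub>M \<alpha>\<^esub>], []) | \<alpha>. \<alpha> \<in> V} \<union>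
     {([x, y], [x \<otimes>\<^bsub>M \<alpha>\<^esub> y]) | \<alpha> x y. \<alpha> \<in> V \<and> x \<in> carrier (M \<alpha>) \<and> y \<in> carrier (M \<alpha>)} \<union>
     {([x, y], [y, x]) | \<alpha> \<beta> x y. {\<alpha>, \<beta>} \<in> E \<and> x \<in> carrier (M \<alpha>) \<and> y \<in> carrier (M \<beta>)}"

definition gp_congruence ::
  "'v set \<Rightarrow> 'v set set \<Rightarrow> ('v \<Rightarrow> ('a, 'b) monoid_scheme) \<Rightarrow> ('a list \<times> 'a list) set" where
  "gp_congruence V E M = generated_congruence (letters V M) (gp_relators V E M)"

definition gp_class ::
  "'v set \<Rightarrow> 'v set set \<Rightarrow> ('v \<Rightarrow> ('a, 'b) monoid_scheme) \<Rightarrow> 'a list \<Rightarrow> 'a list set" where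
  "gp_class V E M w = gp_congruence V E M `` {w}"

definition graph_product ::
  "'v set \<Rightarrow> 'v set set \<Rightarrow> ('v \<Rightarrow> ('a, 'b) monoid_scheme) \<Rightarrow> 'a list set monoid" where
  "graph_product V E M =
     \<lparr>carrier = lists (letters V M) // gp_congruence V E M,
      monoid.mult = (\<lambda>A B. \<Union>u\<in>A. \<Union>v\<in>B. gp_class V E M (u @ v)),
      one = gp_class V E M []\<rparr>"

text \<open>Well defined on \<open>letters V M\<close> because the carriers are pairwise disjoint.\<close>

definition vertex_of :: "'v set \<Rightarrow> ('v \<Rightarrow> ('a, 'b) monoid_scheme) \<Rightarrow> 'a \<Rightarrow> 'v" where
  "vertex_of V M a = (THE \<alpha>. \<alpha> \<in> V \<and> a \<in> carrier (M \<alpha>))"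

definition support :: "'v set \<Rightarrow> ('v \<Rightarrow> ('a, 'b) monoid_scheme) \<Rightarrow> 'a list \<Rightarrow> 'v set" where
  "support V M w = vertex_of V M ` set w"

definition reduced ::
  "'v set \<Rightarrow> 'v set set \<Rightarrow> ('v \<Rightarrow> ('a, 'b) monoid_scheme) \<Rightarrow> 'a list \<Rightarrow> bool" where
  "reduced V E M w \<longleftrightarrow>
     w \<in> lists (letters V M) \<and>
     (\<forall>i<length w. w ! i \<notin> identities V M) \<and>
     (\<forall>i j. i < j \<longrightarrow> j < length w \<longrightarrow> vertex_of V M (w ! i) = vertex_of V M (w ! j) \<longrightarrow>
        (\<exists>k. i < k \<and> k < j \<and> {vertex_of V M (w ! i), vertex_of V M (w ! k)} \<notin> E))"

text \<open>\<open>bs\<close> is the list of blocks, so the block length is \<open>length bs\<close>; condition (iii) is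
  indexed from 0. The case \<open>bs = []\<close> makes the empty word a normal form of block length 0.\<close>

definition left_foata_blocks ::
  "'v set \<Rightarrow> 'v set set \<Rightarrow> ('v \<Rightarrow> ('a, 'b) monoid_scheme) \<Rightarrow> 'a list \<Rightarrow> 'a list list \<Rightarrow> bool" where
  "left_foata_blocks V E M w bs \<longleftrightarrow>
     w = concat bs \<and> reduced V E M w \<and>
     (\<forall>b\<in>set bs. b \<noteq> [] \<and> complete_on E (support V M b)) \<and>
     (\<forall>i. Suc i < length bs \<longrightarrow>
        (\<forall>\<alpha>\<in>support V M (bs ! Suc i). \<exists>\<beta>\<in>support V M (bs ! i). {\<alpha>, \<beta>} \<notin> E))"

definition left_foata_normal_form ::
  "'v set \<Rightarrow> 'v set set \<Rightarrow> ('v \<Rightarrow> ('a, 'b) monoid_scheme) \<Rightarrow> 'a list \<Rightarrow> bool" where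
  "left_foata_normal_form V E M w \<longleftrightarrow> (\<exists>bs. left_foata_blocks V E M w bs)"

end

theory Submission
  imports Defs
begin

text \<open>
  A shortest word of a congruence class is reduced: an identity letter could be deleted, and two
  letters of the same vertex that are separated only by letters adjacent to them could be brought
  together and multiplied. On the other hand, commutation moves alone, which do not change the
  length, bring any word into a product of complete blocks with the Foata property: append the
  letters one at a time, moving each new letter to the left until it is stopped by a block
  containing a vertex not adjacent to it. Applied to a shortest word, this yields a word that is
  again shortest, hence reduced.
\<close>

section \<open>Congruences on a free monoid generated by a relation\<close>

lemma generated_congruence_is_word_congruence:
  assumes "R \<subseteq> lists X \<times> lists X"
  shows "is_word_congruence X (generated_congruence X R)"
proof -
  let ?F = "{r. is_word_congruence X r \<and> R \<subseteq> r}" and ?C = "generated_congruence X R"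
  \<comment> \<open>The full relation belongs to \<open>?F\<close>, so the intersection is not over
    an empty family and stays inside \<open>lists X \<times> lists X\<close>.\<close>
  have "is_word_congruence X (lists X \<times> lists X)"
    unfolding is_word_congruence_def by (auto intro!: equivI refl_onI symI transI)
  then have sub: "?C \<subseteq> lists X \<times> lists X"
    unfolding generated_congruence_def using assms by blast
  have C: "(u, v) \<in> ?C \<longleftrightarrow> (\<forall>r\<in>?F. (u, v) \<in> r)" for u v
    unfolding generated_congruence_def by blast
  have F: "equiv (lists X) r"
    "\<And>u v u' v'. (u, v) \<in> r \<Longrightarrow> (u', v') \<in> r \<Longrightarrow> (u @ u', v @ v') \<in> r" if "r \<in> ?F" for r
    using that unfolding is_word_congruence_def by blast+
  have "equiv (lists X) ?C"
  proof (rule equivI)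
    show "?C \<subseteq> lists X \<times> lists X" by (rule sub)
    show "refl_on (lists X) ?C"
      using F(1) C by (meson equiv_def refl_onD refl_onI)
    show "sym ?C"
      using F(1) C by (meson equivE symD symI)
    show "trans ?C"
      using F(1) C by (meson equivE transD transI)
  qed
  then show ?thesis
    unfolding is_word_congruence_def C using F(2) by blast
qed

lemma generated_congruence_superset: "R \<subseteq> generated_congruence X R"
  unfolding generated_congruence_def by blast

section \<open>Calculating with congruent words in a graph product\<close>

locale monoid_graph_product =
  fixes V :: "'v set" and E :: "'v set set" and M :: "'v \<Rightarrow> ('a, 'b) monoid_scheme"
  assumes simple: "simple_graph V E"
    and monoids: "\<And>\<alpha>. \<alpha> \<in> V \<Longrightarrow> monoid (M \<alpha>)"
    and disjoint: "disjoint_family_on (\<lambda>\<alpha>. carrier (M \<alpha>)) V"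
begin

abbreviation "X \<equiv> letters V M"
abbreviation "s \<equiv> vertex_of V M"
abbreviation "supp \<equiv> support V M"
abbreviation cong (infix \<open>\<approx>\<close> 50) where "u \<approx> v \<equiv> (u, v) \<in> gp_congruence V E M"

lemma vertex_of_eq: "\<alpha> \<in> V \<Longrightarrow> a \<in> carrier (M \<alpha>) \<Longrightarrow> s a = \<alpha>"
  unfolding vertex_of_def using disjoint by (force simp: disjoint_family_on_def)

lemma vertex_of_letter:
  assumes "a \<in> X"
  shows "s a \<in> V" "a \<in> carrier (M (s a))"
  using assms vertex_of_eq unfolding letters_def by auto

text \<open>The commutation relators require only an edge; this puts their letters into
  \<open>X\<close>.\<close>

lemma edge_vertices: "{\<alpha>, \<beta>} \<in> E \<Longrightarrow> \<alpha> \<in> V \<and> \<beta> \<in> V"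
  using simple unfolding simple_graph_def by blast

lemma gp_relators_subset: "gp_relators V E M \<subseteq> lists X \<times> lists X"
proof -
  have "\<one>\<^bsub>M \<alpha>\<^esub> \<in> X" if "\<alpha> \<in> V" for \<alpha>
    using that monoid.one_closed[OF monoids] unfolding letters_def by blast
  moreover have "x \<otimes>\<^bsub>M \<alpha>\<^esub> y \<in> X"
    if "\<alpha> \<in> V" "x \<in> carrier (M \<alpha>)" "y \<in> carrier (M \<alpha>)" for \<alpha> x y
    using that monoid.m_closed[OF monoids] unfolding letters_def by blast
  moreover have "x \<in> X" if "\<alpha> \<in> V" "x \<in> carrier (M \<alpha>)" for \<alpha> x
    using that unfolding letters_def by blast
  ultimately show ?thesis
    unfolding gp_relators_def by (auto dest!: edge_vertices)
qed

lemma gp_congruence_is_word_congruence: "is_word_congruence X (gp_congruence V E M)"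
  unfolding gp_congruence_def
  by (rule generated_congruence_is_word_congruence[OF gp_relators_subset])

lemma gp_congruence_equiv: "equiv (lists X) (gp_congruence V E M)"
  using gp_congruence_is_word_congruence unfolding is_word_congruence_def by blast

lemma cong_refl: "w \<in> lists X \<Longrightarrow> w \<approx> w"
  using gp_congruence_equiv by (meson equiv_def refl_onD)

lemma cong_trans [trans]: "u \<approx> v \<Longrightarrow> v \<approx> w \<Longrightarrow> u \<approx> w"
  using gp_congruence_equiv by (meson equivE transD)

lemma cong_lists: "u \<approx> v \<Longrightarrow> u \<in> lists X \<and> v \<in> lists X"
  using equiv_type[OF gp_congruence_equiv] by blast

lemma cong_append: "u \<approx> v \<Longrightarrow> u' \<approx> v' \<Longrightarrow> u @ u' \<approx> v @ v'"
  using gp_congruence_is_word_congruence unfolding is_word_congruence_def by blast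

lemma cong_context:
  "u \<approx> v \<Longrightarrow> p \<in> lists X \<Longrightarrow> q \<in> lists X \<Longrightarrow> p @ u @ q \<approx> p @ v @ q"
  by (simp add: cong_append cong_refl)

lemma relator_cong: "(u, v) \<in> gp_relators V E M \<Longrightarrow> u \<approx> v"
  unfolding gp_congruence_def using generated_congruence_superset by blast

lemma cong_one: "a \<in> identities V M \<Longrightarrow> [a] \<approx> []"
  by (rule relator_cong) (auto simp: gp_relators_def identities_def)

lemma cong_mult:
  assumes "a \<in> X" "b \<in> X" "s a = s b"
  shows "[a, b] \<approx> [a \<otimes>\<^bsub>M (s a)\<^esub> b]"
proof -
  have "a \<in> carrier (M (s a))" "b \<in> carrier (M (s a))" "s a \<in> V"
    using assms vertex_of_letter by metis+
  then show ?thesis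
    by (intro relator_cong) (auto simp: gp_relators_def)
qed

lemma cong_swap:
  assumes "a \<in> X" "b \<in> X" "{s a, s b} \<in> E"
  shows "[a, b] \<approx> [b, a]"
proof (rule relator_cong)
  have "a \<in> carrier (M (s a))" "b \<in> carrier (M (s b))"
    using assms vertex_of_letter by auto
  then show "([a, b], [b, a]) \<in> gp_relators V E M"
    using assms(3) unfolding gp_relators_def by blast
qed

text \<open>By induction \<open>x\<close> first passes the tail of \<open>ys\<close> and is then
  swapped with the head. This serves both to bring two letters of one vertex together and to carry a
  new letter into its block.\<close>

lemma cong_move_left:
  assumes "x \<in> X" "ys \<in> lists X" "\<And>y. y \<in> set ys \<Longrightarrow> {s x, s y} \<in> E"
  shows "ys @ [x] \<approx> x # ys"
  using assms(2,3)
proof (induction ys rule: list.induct)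
  case Nil
  then show ?case using assms(1) by (simp add: cong_refl)
next
  case (Cons y ys)
  have in_X: "y \<in> X" "ys \<in> lists X"
    using Cons.prems(1) by simp_all
  have "ys @ [x] \<approx> x # ys"
    using Cons by simp
  then have "[y] @ (ys @ [x]) @ [] \<approx> [y] @ (x # ys) @ []"
    using in_X by (intro cong_context) auto
  also have "[y] @ (x # ys) @ [] = [] @ [y, x] @ ys" by simp
  also have "{s y, s x} \<in> E"
    using Cons.prems(2)[of y] by (simp add: insert_commute)
  then have "[] @ [y, x] @ ys \<approx> [] @ [x, y] @ ys"
    using in_X assms(1) by (intro cong_context cong_swap) auto
  finally show ?case by simp
qed

lemma shortest_word_reduced:
  assumes w: "w \<in> lists X" and shortest: "\<And>v. w \<approx> v \<Longrightarrow> length w \<le> length v"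
  shows "reduced V E M w"
proof -
  have no_identity: "w ! i \<notin> identities V M" if "i < length w" for i
  proof
    assume i: "w ! i \<in> identities V M"
    define p q where "p = take i w" and "q = drop (Suc i) w"
    have split: "w = p @ [w ! i] @ q"
      using that unfolding p_def q_def by (simp add: id_take_nth_drop)
    then have "p \<in> lists X" "q \<in> lists X"
      using w by (metis append_in_lists_conv)+
    then have "w \<approx> p @ [] @ q"
      using cong_context[OF cong_one[OF i]] split by metis
    then have "length w \<le> length p + length q"
      using shortest by fastforce
    then show False
      using arg_cong[OF split, of length] by simp
  qed
  have separated: "\<exists>k. i < k \<and> k < j \<and> {s (w ! i), s (w ! k)} \<notin> E"
    if ij: "i < j" "j < length w" "s (w ! i) = s (w ! j)" for i j
  proof (rule ccontr)
    assume "\<not> ?thesis"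
    then have adj: "\<And>k. i < k \<Longrightarrow> k < j \<Longrightarrow> {s (w ! i), s (w ! k)} \<in> E" by blast
    define a b where "a = w ! i" and "b = w ! j"
    \<comment> \<open>\<open>v\<close> is the segment strictly between positions \<open>i\<close>
      and \<open>j\<close>, so that \<open>w\<close> factors as \<open>p\<close>, \<open>a\<close>,
      \<open>v\<close>, \<open>b\<close>, \<open>q\<close>.\<close>
    define p v q where "p = take i w" and "v = drop (Suc i) (take j w)" and "q = drop (Suc j) w"
    have "w = take j w @ b # q"
      using ij unfolding b_def q_def by (simp add: id_take_nth_drop)
    moreover have "take j w = p @ a # v"
      using id_take_nth_drop[of i "take j w"] ij unfolding p_def a_def v_def
      by (simp add: min_def)
    ultimately have split: "w = p @ [a] @ v @ [b] @ q" by simp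
    then have "p @ [a] @ v @ [b] @ q \<in> lists X" using w by simp
    then have in_X: "p \<in> lists X" "a \<in> X" "v \<in> lists X" "b \<in> X" "q \<in> lists X"
      by auto
    \<comment> \<open>\<open>a\<close> and \<open>b\<close> have the same vertex, so adjacency to
      \<open>a\<close> is adjacency to \<open>b\<close>.\<close>
    have "{s b, s y} \<in> E" if y: "y \<in> set v" for y
    proof -
      obtain m where m: "m < length v" "y = v ! m"
        using y unfolding in_set_conv_nth by blast
      then have "y = w ! (Suc i + m)" "Suc i + m < j"
        using ij(1,2) by (simp_all add: v_def less_diff_conv)
      then show ?thesis
        using adj[of "Suc i + m"] ij(3) unfolding b_def by simp
    qed
    then have move: "v @ [b] \<approx> b # v"
      using in_X by (intro cong_move_left) auto
    have "(p @ [a]) @ (v @ [b]) @ q \<approx> (p @ [a]) @ (b # v) @ q"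
      using in_X by (intro cong_context[OF move]) auto
    also have "(p @ [a]) @ (b # v) @ q = p @ [a, b] @ (v @ q)" by simp
    \<comment> \<open>The product replaces two letters by one, against minimality of
      \<open>w\<close>.\<close>
    also have "p @ [a, b] @ (v @ q) \<approx> p @ [a \<otimes>\<^bsub>M (s a)\<^esub> b] @ (v @ q)"
      using in_X ij(3) unfolding a_def b_def by (intro cong_context cong_mult) auto
    finally have "w \<approx> p @ [a \<otimes>\<^bsub>M (s a)\<^esub> b] @ (v @ q)"
      using split by simp
    then have "length w \<le> length (p @ [a \<otimes>\<^bsub>M (s a)\<^esub> b] @ (v @ q))"
      by (rule shortest)
    then show False
      using arg_cong[OF split, of length] by simp
  qed
  show ?thesis
    unfolding reduced_def using w no_identity separated by blast
qed

section \<open>Foata blocks by commutation alone\<close>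

definition foata_step :: "'a list \<Rightarrow> 'a list \<Rightarrow> bool" where
  "foata_step b c \<longleftrightarrow> (\<forall>\<alpha>\<in>supp c. \<exists>\<beta>\<in>supp b. {\<alpha>, \<beta>} \<notin> E)"

text \<open>Reducedness is left out, as it comes from minimal length at the end. Using
  \<open>successively\<close> lets block lists be split and joined without indices.\<close>

definition foata_blocks :: "'a list list \<Rightarrow> bool" where
  "foata_blocks bs \<longleftrightarrow>
     (\<forall>b\<in>set bs. b \<noteq> [] \<and> complete_on E (supp b)) \<and> successively foata_step bs"

lemma left_foata_blocks_iff:
  "left_foata_blocks V E M w bs \<longleftrightarrow> w = concat bs \<and> reduced V E M w \<and> foata_blocks bs"
  unfolding left_foata_blocks_def foata_blocks_def foata_step_def successively_conv_nth
  by blast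

lemma support_snoc: "supp (b @ [x]) = insert (s x) (supp b)"
  unfolding support_def by simp

text \<open>\<open>ps\<close> ends with the last block that stops \<open>x\<close>, or is empty if
  none does. A letter over the vertex of \<open>x\<close> also stops it, since the graph has no
  loops.\<close>

lemma split_at_last_obstruction:
  obtains ps qs where "bs = ps @ qs"
    "\<And>b y. b \<in> set qs \<Longrightarrow> y \<in> set b \<Longrightarrow> {s x, s y} \<in> E"
    "ps \<noteq> [] \<Longrightarrow> \<exists>y\<in>set (last ps). {s x, s y} \<notin> E"
proof (cases "\<exists>b\<in>set bs. \<exists>y\<in>set b. {s x, s y} \<notin> E")
  case True
  then obtain ps b qs where "bs = ps @ b # qs" "\<exists>y\<in>set b. {s x, s y} \<notin> E"
    "\<forall>b\<in>set qs. \<not> (\<exists>y\<in>set b. {s x, s y} \<notin> E)"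
    using split_list_last_prop[of bs "\<lambda>b. \<exists>y\<in>set b. {s x, s y} \<notin> E"] by blast
  then show ?thesis
    using that[of "ps @ [b]" qs] by auto
next
  case False
  then show ?thesis
    using that[of "[]" bs] by auto
qed

text \<open>The letter \<open>x\<close> commutes with all of \<open>qs\<close>, so it can join the
  first block of \<open>qs\<close>, which remains complete. If \<open>qs\<close> is empty,
  \<open>x\<close> opens a new block.\<close>

lemma foata_blocks_insert:
  assumes bs: "foata_blocks bs" and letters: "concat bs \<in> lists X" "x \<in> X"
  shows "\<exists>bs'. foata_blocks bs' \<and> concat bs @ [x] \<approx> concat bs' \<and>
    length (concat bs') = Suc (length (concat bs))"
proof -
  obtain ps qs where split: "bs = ps @ qs"
    and adj: "\<And>b y. b \<in> set qs \<Longrightarrow> y \<in> set b \<Longrightarrow> {s x, s y} \<in> E"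
    and stop: "ps \<noteq> [] \<Longrightarrow> \<exists>y\<in>set (last ps). {s x, s y} \<notin> E"
    using split_at_last_obstruction[of bs x] by blast
  show ?thesis
  proof (cases qs)
    case Nil
    have "foata_blocks (bs @ [[x]])"
      using bs stop Nil split
      by (auto simp: foata_blocks_def foata_step_def successively_append_iff complete_on_def
          support_def)
    moreover have "concat bs @ [x] \<approx> concat (bs @ [[x]])"
      using letters by (simp add: cong_refl)
    ultimately show ?thesis
      by (intro exI[of _ "bs @ [[x]]"]) simp
  next
    case (Cons c cs)
    let ?bs' = "ps @ (c @ [x]) # cs"
    have "complete_on E (supp (c @ [x]))"
    proof -
      have "complete_on E (supp c)"
        using bs split Cons by (simp add: foata_blocks_def)
      moreover have "{s x, \<beta>} \<in> E" if "\<beta> \<in> supp c" for \<beta>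
        using that adj Cons unfolding support_def by auto
      ultimately show ?thesis
        unfolding support_snoc complete_on_def by (auto simp: insert_commute)
    qed
    \<comment> \<open>Vertices of \<open>c\<close> keep their old obstruction in
      \<open>last ps\<close>; for \<open>x\<close> itself \<open>stop\<close> supplies one.\<close>
    moreover have "ps = [] \<or> foata_step (last ps) (c @ [x])"
      using bs stop split Cons
      by (auto simp: foata_blocks_def foata_step_def successively_append_iff support_def)
    \<comment> \<open>Enlarging \<open>c\<close> only adds candidates for obstructing the next
      block.\<close>
    moreover have "cs = [] \<or> foata_step (c @ [x]) (hd cs)"
      using bs split Cons
      by (auto simp: foata_blocks_def foata_step_def successively_append_iff successively_Cons
          support_snoc)
    ultimately have "foata_blocks ?bs'"
      using bs split Cons
      by (auto simp: foata_blocks_def successively_append_iff successively_Cons)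
    moreover have "concat bs @ [x] \<approx> concat ?bs'"
    proof -
      \<comment> \<open>As \<open>x\<close> is placed at the end of \<open>c\<close>, it has to pass
        only the blocks in \<open>cs\<close>.\<close>
      have "concat cs @ [x] \<approx> x # concat cs"
        using letters adj split Cons by (intro cong_move_left) auto
      then have "concat (ps @ [c]) @ (concat cs @ [x]) @ [] \<approx>
          concat (ps @ [c]) @ (x # concat cs) @ []"
        using letters split Cons by (intro cong_context) auto
      then show ?thesis
        using split Cons by simp
    qed
    moreover have "length (concat ?bs') = Suc (length (concat bs))"
      using split Cons by simp
    ultimately show ?thesis by blast
  qed
qed

text \<open>Insert the letters one by one from the left. The equality of lengths is what carries
  minimality over to the rearranged word.\<close>

lemma cong_foata_blocks:
  assumes "w \<in> lists X"
  shows "\<exists>bs. foata_blocks bs \<and> w \<approx> concat bs \<and> length (concat bs) = length w"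
  using assms
proof (induction w rule: rev_induct)
  case Nil
  have "foata_blocks []" by (simp add: foata_blocks_def)
  then show ?case by (intro exI[of _ "[]"]) (simp add: cong_refl)
next
  case (snoc x w)
  then obtain bs where bs: "foata_blocks bs" "w \<approx> concat bs" "length (concat bs) = length w"
    by auto
  then obtain bs' where bs': "foata_blocks bs'" "concat bs @ [x] \<approx> concat bs'"
    "length (concat bs') = Suc (length (concat bs))"
    using foata_blocks_insert cong_lists snoc.prems
    by (metis append_in_lists_conv Cons_in_lists_iff)
  have "w @ [x] \<approx> concat bs @ [x]"
    using bs(2) snoc.prems by (intro cong_append cong_refl) auto
  then have "w @ [x] \<approx> concat bs'"
    using bs'(2) cong_trans by blast
  then show ?case
    using bs bs' by auto
qed

section \<open>Existence of normal forms\<close>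

lemma cong_left_foata_normal_form:
  assumes "u \<in> lists X"
  shows "\<exists>w. left_foata_normal_form V E M w \<and> u \<approx> w"
proof -
  \<comment> \<open>A shortest word exists in the class of \<open>u\<close>, which contains
    \<open>u\<close> itself.\<close>
  obtain v where v: "u \<approx> v" and shortest: "\<And>z. u \<approx> z \<Longrightarrow> length v \<le> length z"
    using ex_has_least_nat[of "\<lambda>v. u \<approx> v" u length] cong_refl[OF assms] by blast
  obtain bs where bs: "foata_blocks bs" "v \<approx> concat bs" "length (concat bs) = length v"
    using cong_foata_blocks cong_lists[OF v] by blast
  have u: "u \<approx> concat bs"
    using v bs(2) by (rule cong_trans)
  \<comment> \<open>A word congruent to \<open>concat bs\<close> is congruent to \<open>u\<close>,
    hence no shorter than \<open>v\<close>.\<close>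
  then have "length (concat bs) \<le> length z" if "concat bs \<approx> z" for z
    using that shortest cong_trans bs(3) by metis
  then have "reduced V E M (concat bs)"
    using cong_lists[OF u] shortest_word_reduced by blast
  then have "left_foata_normal_form V E M (concat bs)"
    using bs(1) unfolding left_foata_normal_form_def left_foata_blocks_iff by blast
  then show ?thesis
    using u by blast
qed

end

theorem proposition3p18:
  fixes V :: "'v set" and E :: "'v set set" and M :: "'v \<Rightarrow> ('a, 'b) monoid_scheme"
  assumes "simple_graph V E"
    and "infinite V \<or> card V \<ge> 2"
    and "\<And>\<alpha>. \<alpha> \<in> V \<Longrightarrow> monoid (M \<alpha>)"
    and "disjoint_family_on (\<lambda>\<alpha>. carrier (M \<alpha>)) V"
  shows "\<forall>g\<in>carrier (graph_product V E M).
           \<exists>w. left_foata_normal_form V E M w \<and> g = gp_class V E M w"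
proof
  interpret monoid_graph_product V E M
    by (rule monoid_graph_product.intro) (fact assms)+
  fix g assume "g \<in> carrier (graph_product V E M)"
  then obtain u where u: "u \<in> lists X" "g = gp_class V E M u"
    unfolding graph_product_def gp_class_def by (auto simp: quotient_def)
  then obtain w where w: "left_foata_normal_form V E M w" "u \<approx> w"
    using cong_left_foata_normal_form by blast
  \<comment> \<open>Words related by an equivalence have the same image under it.\<close>
  then have "g = gp_class V E M w"
    using u(2) equiv_class_eq[OF gp_congruence_equiv] unfolding gp_class_def by blast
  then show "\<exists>w. left_foata_normal_form V E M w \<and> g = gp_class V E M w"
    using w(1) by blast
qed

end
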